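(* Let $A$ and $M$ be two graded spaces. Assume that $(sA,\{\mathfrak{m}_n\}_{n\geq 1})$ is an $A_\infty[1]$-algebra and $(sM,\{\varrho_n\}_{n\geq 1})$ is an $sA$-bimodule. A degree $-1$ element $B=\sum_{i\geq 1}B_i\in\mathrm{Hom}(\overline{T^c}(sM),A)$ with $B_i:(sM)^{\otimes i}\to A$ is a homotopy relative Rota-Baxter operator of weight $0$ on $A$ with respect to $M$ if and only if $A\oplus M$ is a homotopy Nijenhuis associative algebra corresponding to the Maurer-Cartan element $(\{b_n\}_{n\geq 1},\{R_n\}_{n\geq 1})$ with $b_n=\mathfrak{m}_n+\varrho_n$ and $R_n=B_n$ for $n\geq 1$.
   Context: $\mathbf{k}$ is a field of characteristic $0$; gradings are homological; $sV$ is the suspension with $(sV)_n=V_{n-1}$; $\overline{T^c}(sV)=\bigoplus_{n\geq 1}(sV)^{\otimes n}$; Koszul signs are used. Maps defined on some of the summands of $(sA\oplus sM)^{\otimes n}$ are extended by zero to the other summands, and maps with values in a summand are viewed as maps into the direct sum. For multilinear maps $f$ of arity $m$ and $g_1,\dots,g_k$ on a graded space, the brace is $f\{g_1,\dots,g_k\}=\sum_{a_0+\cdots+a_k+k=m}f\circ(\mathrm{id}^{\otimes a_0}\otimes g_1\otimes\mathrm{id}^{\otimes a_1}\otimes\cdots\otimes g_k\otimes\mathrm{id}^{\otimes a_k})$ (zero if $k>m$; $f\{\}=f$). For a map $g$ with values in $V$, $sg=s\circ g$. $A_\infty[1]$-algebra: a graded space $\mathfrak{A}$ with maps $\mathfrak{m}_k:\mathfrak{A}^{\otimes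 k}\to\mathfrak{A}$, $k\geq 1$, of degree $-1$ with $\sum_{i+j=n+1}\mathfrak{m}_j\{\mathfrak{m}_i\}=0$ for all $n\geq 1$. Bimodule: an $\mathfrak{A}$-bimodule structure on a dg space $(\mathfrak{M},\varrho_1)$ ($\varrho_1$ of degree $-1$) is a family of maps $\varrho_k=\sum_{p=1}^{k}\varrho_k^p$, $k\geq 2$, with $\varrho_k^p:\mathfrak{A}^{\otimes(p-1)}\otimes\mathfrak{M}\otimes\mathfrak{A}^{\otimes(k-p)}\to\mathfrak{M}$ of degree $-1$, such that $\sum_{i+j=n+1}(\varrho_j\{\mathfrak{m}_i\}+\varrho_j\{\varrho_i\})=0$ for all $n\geq 1$. Homotopy relative Rota-Baxter operator of weight $0$ on $A$ with respect to $M$: a degree $-1$ element $B=\sum_{i\geq 1}B_i\in\mathrm{Hom}(\overline{T^c}(sM),A)$ such that for all $n\geq 1$ $$\sum_{\substack{r_1+\cdots+r_p=n\\ r_1,\dots,r_p\geq 1,\ p\geq 1}}\mathfrak{m}_p\{sB_{r_1},\dots,sB_{r_p}\}=\sum_{\substack{r_1+\cdots+r_p=n\\ r_1,\dots,r_p\geq 1,\ p\geq 1}}(sB_{r_1})\{\varrho_p\{sB_{r_2},\dots,sB_{r_p}\}\}.$$ Homotopy Nijenhuis associative algebra structure on a graded space $V$: a Maurer-Cartan element of a certain $L_\infty$-algebra, explicitly a pair $(\{b_i\}_{i\geq 1},\{R_i\}_{i\geq 1})$ of families of degree $-1$ maps $b_i:(sV)^{\otimes i}\to sV$ and $R_i:(sV)^{\otimes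 i}\to V$ such that for all $n\geq 1$ $$\sum_{i=1}^{n}b_{n-i+1}\{b_i\}=0,\qquad \sum_{\substack{r_1+\cdots+r_p=n\\ r_1,\dots,r_p\geq 1,\ 1\leq p\leq n}}\ \sum_{t=0}^{p}(-1)^t(sR_{r_1})\{\cdots\{sR_{r_t}\{b_p\{sR_{r_{t+1}},\dots,sR_{r_p}\}\}\}\cdots\}=0.$$ *)

theory Defs
  imports "HOL-Analysis.Product_Vector"
begin

section \<open>Graded spaces\<close>

text \<open>A graded space is a vector space, carried by a whole type, together with a family of
  homogeneous components of which it is the direct sum.\<close>

definition homogeneous_decomp :: "(int \<Rightarrow> 'v set) \<Rightarrow> (int \<Rightarrow> 'v::ab_group_add) \<Rightarrow> 'v \<Rightarrow> bool" where
  "homogeneous_decomp G c v \<longleftrightarrow>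
     (\<forall>n. c n \<in> G n) \<and> finite {n. c n \<noteq> 0} \<and> v = (\<Sum>n | c n \<noteq> 0. c n)"

definition graded_space :: "('k::field \<Rightarrow> 'v::ab_group_add \<Rightarrow> 'v) \<Rightarrow> (int \<Rightarrow> 'v set) \<Rightarrow> bool" where
  "graded_space sc G \<longleftrightarrow>
     vector_space sc \<and> (\<forall>n. module.subspace sc (G n)) \<and>
     (\<forall>v. \<exists>!c. homogeneous_decomp G c v)"

definition component :: "(int \<Rightarrow> 'v set) \<Rightarrow> 'v::ab_group_add \<Rightarrow> int \<Rightarrow> 'v" where
  "component G v = (THE c. homogeneous_decomp G c v)"

text \<open>The suspension has the same underlying vector space, with the grading shifted, so the
  degree \<open>1\<close> map \<open>s\<close> is the identity on vectors.\<close>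

definition susp :: "(int \<Rightarrow> 'v set) \<Rightarrow> int \<Rightarrow> 'v set" where
  "susp G n = G (n - 1)"

definition dsum_grading :: "(int \<Rightarrow> 'a set) \<Rightarrow> (int \<Rightarrow> 'm set) \<Rightarrow> int \<Rightarrow> ('a \<times> 'm) set" where
  "dsum_grading G H n = G n \<times> H n"

text \<open>\<open>koszul G e\<close> is the linear map multiplying a homogeneous element \<open>v\<close> by
  \<open>(-1)\<close> to the power \<open>e * degree v\<close>: the sign created when a map of degree \<open>e\<close> moves past
  \<open>v\<close>.\<close>

definition koszul :: "(int \<Rightarrow> 'v set) \<Rightarrow> int \<Rightarrow> 'v::ab_group_add \<Rightarrow> 'v" where
  "koszul G e v = (\<Sum>n | component G v n \<noteq> 0.
     if even (e * n) then component G v n else - component G v n)"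

lemma koszul_homogeneous:
  assumes "graded_space sc G" and "v \<in> G n"
  shows "koszul G e v = (if even (e * n) then v else - v)"
proof -
  define c where "c = (\<lambda>i. if i = n then v else 0)"
  have vs: "vector_space sc" and sub: "\<And>n. module.subspace sc (G n)"
    and ex1: "\<exists>!c. homogeneous_decomp G c v"
    using assms(1) by (auto simp: graded_space_def)
  interpret vector_space sc by (fact vs)
  have supp: "{i. c i \<noteq> 0} = (if v = 0 then {} else {n})" by (auto simp: c_def)
  have "homogeneous_decomp G c v"
    unfolding homogeneous_decomp_def supp
    using sub assms(2) by (auto simp: c_def subspace_0)
  hence "component G v = c"
    unfolding component_def using ex1 by (rule the1_equality[rotated])
  thus ?thesis unfolding koszul_def using supp by (auto simp: c_def)
qed

section \<open>Multilinear maps of a given degree\<close>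

text \<open>A linear map out of a tensor power of order \<open>n\<close> is given as a multilinear function of
  lists of length \<open>n\<close>; its values on lists of any other length are irrelevant.\<close>

definition multilinear ::
  "('k::field \<Rightarrow> 'v::ab_group_add \<Rightarrow> 'v) \<Rightarrow> ('k \<Rightarrow> 'w::ab_group_add \<Rightarrow> 'w) \<Rightarrow> nat \<Rightarrow>
   ('v list \<Rightarrow> 'w) \<Rightarrow> bool" where
  "multilinear s1 s2 n f \<longleftrightarrow>
     (\<forall>xs i. length xs = n \<longrightarrow> i < n \<longrightarrow> Vector_Spaces.linear s1 s2 (\<lambda>v. f (xs[i := v])))"

definition graded_multilinear ::
  "('k::field \<Rightarrow> 'v::ab_group_add \<Rightarrow> 'v) \<Rightarrow> (int \<Rightarrow> 'v set) \<Rightarrow>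
   ('k \<Rightarrow> 'w::ab_group_add \<Rightarrow> 'w) \<Rightarrow> (int \<Rightarrow> 'w set) \<Rightarrow> nat \<Rightarrow> int \<Rightarrow> ('v list \<Rightarrow> 'w) \<Rightarrow> bool" where
  "graded_multilinear s1 G s2 H n d f \<longleftrightarrow>
     multilinear s1 s2 n f \<and>
     (\<forall>xs es. length xs = n \<longrightarrow> list_all2 (\<lambda>x e. x \<in> G e) xs es \<longrightarrow> f xs \<in> H (d + sum_list es))"

text \<open>Maps out of \<open>A\<^sup>p \<otimes> M \<otimes> A\<^sup>q\<close> (tensor powers).\<close>

definition graded_bimodule_map ::
  "('k::field \<Rightarrow> 'a::ab_group_add \<Rightarrow> 'a) \<Rightarrow> (int \<Rightarrow> 'a set) \<Rightarrow>
   ('k \<Rightarrow> 'm::ab_group_add \<Rightarrow> 'm) \<Rightarrow> (int \<Rightarrow> 'm set) \<Rightarrow> nat \<Rightarrow> nat \<Rightarrow> int \<Rightarrow>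
   ('a list \<Rightarrow> 'm \<Rightarrow> 'a list \<Rightarrow> 'm) \<Rightarrow> bool" where
  "graded_bimodule_map sA GA sM GM p q d f \<longleftrightarrow>
     (\<forall>xs ys. length xs = p \<longrightarrow> length ys = q \<longrightarrow> Vector_Spaces.linear sM sM (\<lambda>u. f xs u ys)) \<and>
     (\<forall>u ys. length ys = q \<longrightarrow> multilinear sA sM p (\<lambda>xs. f xs u ys)) \<and>
     (\<forall>xs u. length xs = p \<longrightarrow> multilinear sA sM q (\<lambda>ys. f xs u ys)) \<and>
     (\<forall>xs u ys ds e es. length xs = p \<longrightarrow> length ys = q \<longrightarrow>
        list_all2 (\<lambda>x i. x \<in> GA i) xs ds \<longrightarrow> u \<in> GM e \<longrightarrow> list_all2 (\<lambda>y i. y \<in> GA i) ys es \<longrightarrow>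
        f xs u ys \<in> GM (d + sum_list ds + e + sum_list es))"

section \<open>Braces\<close>

text \<open>A multilinear operation on a space, bundled with its arity and its degree, both of which
  enter the brace.\<close>

datatype 'v mop = Mop (arity: nat) (degree: int) (app: "'v list \<Rightarrow> 'v")

text \<open>\<open>plug G [a\<^sub>0, \<dots>, a\<^sub>k] [g\<^sub>1, \<dots>, g\<^sub>k] xs\<close> lists the tensor factors of
  \<open>(id\<^sup>a\<^sup>0 \<otimes> g\<^sub>1 \<otimes> id\<^sup>a\<^sup>1 \<otimes> \<dots> \<otimes> g\<^sub>k \<otimes> id\<^sup>a\<^sup>k) (x\<^sub>1 \<otimes> \<dots> \<otimes> x\<^sub>N)\<close>.
  Each \<open>g\<^sub>j\<close> moves past every \<open>x\<^sub>i\<close> preceding its own inputs. The last equation is a dummy.\<close>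

fun plug :: "(int \<Rightarrow> 'v::ab_group_add set) \<Rightarrow> nat list \<Rightarrow> 'v mop list \<Rightarrow> 'v list \<Rightarrow> 'v list" where
  "plug G (a # as) (g # gs) xs =
     map (koszul G (degree g + sum_list (map degree gs))) (take a xs) @
     [app g (map (koszul G (sum_list (map degree gs))) (take (arity g) (drop a xs)))] @
     plug G as gs (drop (a + arity g) xs)"
| "plug G [a] [] xs = xs"
| "plug G _ _ xs = []"

definition brace :: "(int \<Rightarrow> 'v::ab_group_add set) \<Rightarrow> 'v mop \<Rightarrow> 'v mop list \<Rightarrow> 'v mop" where
  "brace G f gs = Mop
     (arity f + sum_list (map arity gs) - length gs)
     (degree f + sum_list (map degree gs))
     (\<lambda>xs. \<Sum>as | length as = length gs + 1 \<and> sum_list as + length gs = arity f.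
        app f (plug G as gs xs))"

text \<open>Composition with \<open>s\<close>: only the degree changes.\<close>

definition smop :: "'v mop \<Rightarrow> 'v mop" where
  "smop g = Mop (arity g) (degree g + 1) (app g)"

text \<open>The sequences \<open>r\<^sub>1, \<dots>, r\<^sub>p \<ge> 1\<close> with \<open>p \<ge> 1\<close> and sum \<open>n\<close>.\<close>

definition compositions :: "nat \<Rightarrow> nat list set" where
  "compositions n = {rs. rs \<noteq> [] \<and> (\<forall>r\<in>set rs. 1 \<le> r) \<and> sum_list rs = n}"

section \<open>\<open>A\<^sub>\<infinity>[1]\<close>-algebras and bimodules\<close>

definition A_infinity_1_algebra ::
  "('k::field \<Rightarrow> 'v::ab_group_add \<Rightarrow> 'v) \<Rightarrow> (int \<Rightarrow> 'v set) \<Rightarrow> (nat \<Rightarrow> 'v list \<Rightarrow> 'v) \<Rightarrow> bool" where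
  "A_infinity_1_algebra sc G m \<longleftrightarrow>
     graded_space sc G \<and>
     (\<forall>k\<ge>1. graded_multilinear sc G sc G k (-1) (m k)) \<and>
     (\<forall>n\<ge>1. \<forall>xs. length xs = n \<longrightarrow>
        (\<Sum>(i, j) | 1 \<le> i \<and> 1 \<le> j \<and> i + j = n + 1.
           app (brace G (Mop j (-1) (m j)) [Mop i (-1) (m i)]) xs) = 0)"

text \<open>Extensions by zero to the tensor powers of the direct sum, viewed as maps into the direct
  sum.\<close>

definition ext_fst :: "('a list \<Rightarrow> 'a) \<Rightarrow> ('a \<times> 'm) list \<Rightarrow> 'a \<times> ('m::zero)" where
  "ext_fst f xs = (f (map fst xs), 0)"

definition ext_snd :: "('m list \<Rightarrow> 'a) \<Rightarrow> ('a \<times> 'm) list \<Rightarrow> 'a \<times> ('m::zero)" where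
  "ext_snd f xs = (f (map snd xs), 0)"

text \<open>\<open>\<rho> k p\<close> stands for the component with the module argument in position
  \<open>p\<close> (counted from 1) out of \<open>k\<close>; \<open>ext_bimod \<rho> k\<close> is the sum of these over \<open>p\<close>.\<close>

definition ext_bimod ::
  "(nat \<Rightarrow> nat \<Rightarrow> 'a list \<Rightarrow> 'm \<Rightarrow> 'a list \<Rightarrow> 'm) \<Rightarrow> nat \<Rightarrow>
   ('a::ab_group_add \<times> 'm::ab_group_add) list \<Rightarrow> 'a \<times> 'm" where
  "ext_bimod \<rho> k xs = (\<Sum>p = 1..k.
     (0, \<rho> k p (map fst (take (p - 1) xs)) (snd (xs ! (p - 1))) (map fst (drop p xs))))"

text \<open>The dg structure of the module is \<open>\<rho> 1 1\<close>, a map with no algebra arguments.\<close>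

definition A_infinity_1_bimodule ::
  "('k::field \<Rightarrow> 'a::ab_group_add \<Rightarrow> 'a) \<Rightarrow> (int \<Rightarrow> 'a set) \<Rightarrow> (nat \<Rightarrow> 'a list \<Rightarrow> 'a) \<Rightarrow>
   ('k \<Rightarrow> 'm::ab_group_add \<Rightarrow> 'm) \<Rightarrow> (int \<Rightarrow> 'm set) \<Rightarrow>
   (nat \<Rightarrow> nat \<Rightarrow> 'a list \<Rightarrow> 'm \<Rightarrow> 'a list \<Rightarrow> 'm) \<Rightarrow> bool" where
  "A_infinity_1_bimodule sA GA m sM GM \<rho> \<longleftrightarrow>
     graded_space sM GM \<and>
     (\<forall>u. \<rho> 1 1 [] (\<rho> 1 1 [] u []) [] = 0) \<and>
     (\<forall>k p. 1 \<le> p \<longrightarrow> p \<le> k \<longrightarrow> graded_bimodule_map sA GA sM GM (p - 1) (k - p) (-1) (\<rho> k p)) \<and>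
     (let G = dsum_grading GA GM;
          m' = (\<lambda>k. Mop k (-1) (ext_fst (m k)));
          \<rho>' = (\<lambda>k. Mop k (-1) (ext_bimod \<rho> k))
      in \<forall>n\<ge>1. \<forall>xs. length xs = n \<longrightarrow>
           (\<Sum>(i, j) | 1 \<le> i \<and> 1 \<le> j \<and> i + j = n + 1.
              app (brace G (\<rho>' j) [m' i]) xs + app (brace G (\<rho>' j) [\<rho>' i]) xs) = 0)"

section \<open>Homotopy relative Rota-Baxter operators and homotopy Nijenhuis algebras\<close>

text \<open>\<open>GA\<close> and \<open>GM\<close> are the gradings of \<open>A\<close> and \<open>M\<close>; the operations \<open>m\<close> and \<open>\<rho>\<close> live on the
  suspensions. An element of degree \<open>-1\<close> of the Hom space out of the reduced tensor coalgebra is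
  given by its family of components.\<close>

definition homotopy_map ::
  "('k::field \<Rightarrow> 'a::ab_group_add \<Rightarrow> 'a) \<Rightarrow> (int \<Rightarrow> 'a set) \<Rightarrow>
   ('k \<Rightarrow> 'm::ab_group_add \<Rightarrow> 'm) \<Rightarrow> (int \<Rightarrow> 'm set) \<Rightarrow> (nat \<Rightarrow> 'm list \<Rightarrow> 'a) \<Rightarrow> bool" where
  "homotopy_map sA GA sM GM B \<longleftrightarrow>
     (\<forall>i\<ge>1. graded_multilinear sM (susp GM) sA GA i (-1) (B i))"

definition homotopy_rel_Rota_Baxter ::
  "('k::field \<Rightarrow> 'a::ab_group_add \<Rightarrow> 'a) \<Rightarrow> (int \<Rightarrow> 'a set) \<Rightarrow> (nat \<Rightarrow> 'a list \<Rightarrow> 'a) \<Rightarrow>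
   ('k \<Rightarrow> 'm::ab_group_add \<Rightarrow> 'm) \<Rightarrow> (int \<Rightarrow> 'm set) \<Rightarrow>
   (nat \<Rightarrow> nat \<Rightarrow> 'a list \<Rightarrow> 'm \<Rightarrow> 'a list \<Rightarrow> 'm) \<Rightarrow> (nat \<Rightarrow> 'm list \<Rightarrow> 'a) \<Rightarrow> bool" where
  "homotopy_rel_Rota_Baxter sA GA m sM GM \<rho> B \<longleftrightarrow>
     homotopy_map sA GA sM GM B \<and>
     (let G = dsum_grading (susp GA) (susp GM);
          m' = (\<lambda>k. Mop k (-1) (ext_fst (m k)));
          \<rho>' = (\<lambda>k. Mop k (-1) (ext_bimod \<rho> k));
          sB = (\<lambda>r. smop (Mop r (-1) (ext_snd (B r))))
      in \<forall>n\<ge>1. \<forall>xs. length xs = n \<longrightarrow>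
           (\<Sum>rs\<in>compositions n. app (brace G (m' (length rs)) (map sB rs)) xs) =
           (\<Sum>rs\<in>compositions n.
              app (brace G (sB (hd rs)) [brace G (\<rho>' (length rs)) (map sB (tl rs))]) xs))"

definition homotopy_Nijenhuis_algebra ::
  "('k::field \<Rightarrow> 'v::ab_group_add \<Rightarrow> 'v) \<Rightarrow> (int \<Rightarrow> 'v set) \<Rightarrow>
   (nat \<Rightarrow> 'v list \<Rightarrow> 'v) \<Rightarrow> (nat \<Rightarrow> 'v list \<Rightarrow> 'v) \<Rightarrow> bool" where
  "homotopy_Nijenhuis_algebra sc G b R \<longleftrightarrow>
     graded_space sc G \<and>
     (\<forall>i\<ge>1. graded_multilinear sc (susp G) sc (susp G) i (-1) (b i)) \<and>
     (\<forall>i\<ge>1. graded_multilinear sc (susp G) sc G i (-1) (R i)) \<and>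
     (let b' = (\<lambda>k. Mop k (-1) (b k));
          sR = (\<lambda>r. smop (Mop r (-1) (R r)))
      in \<forall>n\<ge>1. \<forall>xs. length xs = n \<longrightarrow>
           (\<Sum>i = 1..n. app (brace (susp G) (b' (n - i + 1)) [b' i]) xs) = 0 \<and>
           (\<Sum>rs\<in>compositions n. \<Sum>t = 0..length rs.
              sc ((-1) ^ t)
                (app (foldr (\<lambda>r g. brace (susp G) (sR r) [g]) (take t rs)
                        (brace (susp G) (b' (length rs)) (map sR (drop t rs)))) xs)) = 0)"

end

theory Submission
  imports Defs "HOL-Library.FuncSet"
begin

text \<open>Write \<open>b = m + \<rho>\<close> and \<open>R = B\<close> on \<open>A \<oplus> M\<close>. Everything follows from where the operations take
  their arguments and where their values lie: \<open>m\<close> reads arguments in \<open>A\<close> and has values in \<open>A\<close>,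
  \<open>\<rho>\<close> reads exactly one argument in \<open>M\<close> and has values in \<open>M\<close>, and \<open>B\<close> reads arguments in \<open>M\<close> and
  has values in \<open>A\<close>. A composite in which a value lands in the wrong summand vanishes by
  multilinearity.

  The associativity part of the Nijenhuis structure therefore holds for every \<open>B\<close>
  (\<open>A_infinity_dsum\<close>): in \<open>b{b} = m{m} + m{\<rho>} + \<rho>{m} + \<rho>{\<rho>}\<close> the term \<open>m{\<rho>}\<close> is zero, the terms
  \<open>m{m}\<close> sum to zero by the algebra identities, and the last two by the bimodule identities.

  In the alternating sum of the operator identity (\<open>Nijenhuis_sum_dsum\<close>) only two values of \<open>t\<close>
  survive, for each composition separately. For \<open>t = 0\<close> all inputs of \<open>b\<^sub>p\<close> are values of \<open>B\<close>,
  hence in \<open>A\<close>, so \<open>\<rho>\<close> finds no module argument and \<open>m\<^sub>p{sB, \<dots>, sB}\<close> remains. For \<open>t = 1\<close> the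
  outer \<open>sB\<close> sees only the \<open>M\<close>-part of \<open>b\<^sub>p{\<dots>}\<close>, which gives \<open>- sB{\<rho>\<^sub>p{sB, \<dots>, sB}}\<close>. For \<open>t \<ge> 2\<close> the
  outermost \<open>sB\<close> is fed a value of \<open>sB\<close>, which lies in \<open>A\<close>. What is left is the difference of the
  two sides of the Rota-Baxter identity. None of this interferes with the Koszul signs: they act on
  the two summands separately, and the same signs occur on both sides.\<close>

section \<open>Multilinear maps\<close>

lemma multilinear_add:
  assumes "multilinear s1 s2 (length us + 1 + length vs) f"
  shows "f (us @ (x + y) # vs) = f (us @ x # vs) + f (us @ y # vs)"
proof -
  have "Vector_Spaces.linear s1 s2 (\<lambda>v. f ((us @ x # vs)[length us := v]))"
    using assms unfolding multilinear_def by (metis length_append length_Cons add_Suc_right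
        Suc_eq_plus1 add.assoc add.commute less_add_Suc1)
  then show ?thesis by (simp add: Vector_Spaces.linear_iff)
qed

lemma linear_map_zero:
  assumes "Vector_Spaces.linear s1 s2 f"
  shows "f 0 = 0"
proof -
  have "f (0 + 0) = f 0 + f 0" using assms unfolding Vector_Spaces.linear_iff by blast
  then show ?thesis by simp
qed

lemma multilinear_zero:
  assumes "multilinear s1 s2 n f" "length xs = n" "0 \<in> set xs"
  shows "f xs = 0"
proof -
  obtain i where i: "i < n" "xs ! i = 0" using assms by (auto simp: in_set_conv_nth)
  have "Vector_Spaces.linear s1 s2 (\<lambda>v. f (xs[i := v]))"
    using assms i unfolding multilinear_def by blast
  from linear_map_zero[OF this] show ?thesis using i by (metis list_update_id)
qed

section \<open>Direct sums of graded spaces\<close>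

lemma scale_prod_eq:
  assumes "vector_space sA" "vector_space sM"
  shows "module_prod.scale sA sM a v = (sA a (fst v), sM a (snd v))"
proof -
  interpret vector_space_prod sA sM
    using assms by (simp add: vector_space_prod_def vector_space_pair_def)
  show ?thesis by (rule scale_def)
qed

lemma vector_space_prod_scale:
  assumes "vector_space sA" "vector_space sM"
  shows "vector_space (module_prod.scale sA sM)"
proof -
  interpret vector_space_prod sA sM
    using assms by (simp add: vector_space_prod_def vector_space_pair_def)
  show ?thesis by unfold_locales
qed

text \<open>The support of \<open>c\<close> is the union of the supports of its two halves, so each half is summed over
  degrees outside its own support, where it contributes zero.\<close>

lemma homogeneous_decomp_dsum:
  "homogeneous_decomp (dsum_grading G H) c v \<longleftrightarrow>
     homogeneous_decomp G (\<lambda>n. fst (c n)) (fst v) \<and> homogeneous_decomp H (\<lambda>n. snd (c n)) (snd v)"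
proof -
  let ?S = "{n. c n \<noteq> 0}" and ?F = "{n. fst (c n) \<noteq> 0}" and ?T = "{n. snd (c n) \<noteq> 0}"
  have S: "?S = ?F \<union> ?T" by (auto simp: prod_eq_iff)
  show ?thesis
  proof (cases "finite ?S")
    case True
    have "fst (\<Sum>n\<in>?S. c n) = (\<Sum>n\<in>?F. fst (c n))"
      unfolding fst_sum using True by (intro sum.mono_neutral_right) (auto simp: S)
    moreover have "snd (\<Sum>n\<in>?S. c n) = (\<Sum>n\<in>?T. snd (c n))"
      unfolding snd_sum using True by (intro sum.mono_neutral_right) (auto simp: S)
    ultimately show ?thesis
      using True unfolding homogeneous_decomp_def dsum_grading_def S
      by (auto simp: prod_eq_iff mem_Times_iff)
  next
    case False
    then show ?thesis by (auto simp: homogeneous_decomp_def S)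
  qed
qed

lemma homogeneous_decomp_component:
  assumes "graded_space sc G"
  shows "homogeneous_decomp G c v \<longleftrightarrow> c = component G v"
  using assms unfolding graded_space_def component_def by (metis the1_equality)

lemma graded_space_dsum:
  assumes "graded_space sA GA" "graded_space sM GM"
  shows "graded_space (module_prod.scale sA sM) (dsum_grading GA GM)"
proof -
  have vs: "vector_space sA" "vector_space sM" using assms by (auto simp: graded_space_def)
  interpret vector_space_prod sA sM
    using vs by (simp add: vector_space_prod_def vector_space_pair_def)
  have "\<exists>!c. homogeneous_decomp (dsum_grading GA GM) c v" for v
  proof (rule ex1I)
    show "homogeneous_decomp (dsum_grading GA GM)
        (\<lambda>n. (component GA (fst v) n, component GM (snd v) n)) v"
      by (simp add: homogeneous_decomp_dsum homogeneous_decomp_component[OF assms(1)]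
          homogeneous_decomp_component[OF assms(2)])
    show "c = (\<lambda>n. (component GA (fst v) n, component GM (snd v) n))"
      if "homogeneous_decomp (dsum_grading GA GM) c v" for c
      using that unfolding homogeneous_decomp_dsum homogeneous_decomp_component[OF assms(1)]
        homogeneous_decomp_component[OF assms(2)]
      by (metis (no_types, lifting) ext prod.collapse)
  qed
  moreover have "p.subspace (dsum_grading GA GM n)" for n
    using assms unfolding dsum_grading_def graded_space_def by (blast intro: subspace_Times)
  ultimately show ?thesis
    using vector_space_prod_scale[OF vs] by (simp add: graded_space_def)
qed

lemma susp_dsum: "susp (dsum_grading G H) = dsum_grading (susp G) (susp H)"
  by (auto simp: susp_def dsum_grading_def fun_eq_iff)

text \<open>Projecting to \<open>A\<close> commutes with Koszul signs, so that braces on the direct sum of operations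
  in \<open>A\<close> restrict to the braces on \<open>A\<close>.\<close>

lemma fst_koszul_dsum:
  fixes sA :: "'k::field \<Rightarrow> 'a::ab_group_add \<Rightarrow> 'a" and sM :: "'k \<Rightarrow> 'm::ab_group_add \<Rightarrow> 'm"
  assumes "graded_space sA GA" "graded_space sM GM"
  shows "fst (koszul (dsum_grading GA GM) e v) = koszul GA e (fst v)"
proof -
  define c where "c = component (dsum_grading GA GM) v"
  have dec: "homogeneous_decomp (dsum_grading GA GM) c v"
    unfolding c_def by (simp add: homogeneous_decomp_component[OF graded_space_dsum[OF assms]])
  then have fin: "finite {n. c n \<noteq> 0}" by (simp add: homogeneous_decomp_def)
  have comp: "component GA (fst v) = (\<lambda>n. fst (c n))"
    using dec by (simp add: homogeneous_decomp_dsum homogeneous_decomp_component[OF assms(1)])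
  show ?thesis
    unfolding koszul_def comp c_def[symmetric] fst_sum
    by (rule sum.mono_neutral_cong_right) (auto simp: fin split: if_splits)
qed

section \<open>Braces\<close>

text \<open>A brace with one inserted operation is a sum over its insertion position \<open>a\<close> alone, as the number
  of untouched arguments to its right is then forced.\<close>

lemma brace_single:
  "app (brace G f [g]) xs = (\<Sum>a<arity f.
     app f (map (koszul G (degree g)) (take a xs) @
       app g (map (koszul G 0) (take (arity g) (drop a xs))) # drop (a + arity g) xs))"
proof -
  have "bij_betw (\<lambda>a. [a, arity f - 1 - a]) {..<arity f}
      {as. length as = length [g] + 1 \<and> sum_list as + length [g] = arity f}"
    by (rule bij_betwI[where g = hd]) (auto simp: length_Suc_conv)
  from sum.reindex_bij_betw[OF this, of "\<lambda>as. app f (plug G as [g] xs)", symmetric]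
  show ?thesis by (simp add: brace_def)
qed

lemma brace_add_left:
  "app (brace G (Mop j d (\<lambda>xs. f xs + f' xs)) gs) xs =
     app (brace G (Mop j d f) gs) xs + app (brace G (Mop j d f') gs) xs"
  by (simp add: brace_def sum.distrib)

text \<open>The length condition makes every list on which \<open>f\<close> is evaluated have length \<open>j\<close>, which is where
  multilinearity applies.\<close>

lemma brace_add_right:
  assumes "multilinear s1 s2 j f" "1 \<le> i" "length xs + 1 = i + j"
  shows "app (brace G (Mop j d f) [Mop i e (\<lambda>xs. g xs + g' xs)]) xs =
     app (brace G (Mop j d f) [Mop i e g]) xs + app (brace G (Mop j d f) [Mop i e g']) xs"
  unfolding brace_single sum.distrib[symmetric] mop.sel
proof (rule sum.cong[OF refl], rule multilinear_add)
  fix a assume "a \<in> {..<j}"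
  then have "length (map (koszul G e) (take a xs)) + 1 + length (drop (a + i) xs) = j"
    using assms by auto
  then show "multilinear s1 s2
      (length (map (koszul G e) (take a xs)) + 1 + length (drop (a + i) xs)) f"
    using assms(1) by simp
qed

text \<open>An operation on \<open>A\<close> is killed by an inserted value in \<open>M\<close>; its counterpart below says that an
  operation reading \<open>M\<close> is killed by an inserted value in \<open>A\<close>. These two facts dispose of
  \<open>m{\<rho>}\<close> and of the nested braces \<open>sB{sB{\<dots>}}\<close>.\<close>

lemma brace_ext_fst_vanishes:
  assumes "multilinear s1 s2 r f" "\<And>ys. fst (app g ys) = 0" "length xs + 1 = r + arity g"
  shows "app (brace G (Mop r d (ext_fst f)) [g]) xs = 0"
  unfolding brace_single
proof (rule sum.neutral, rule ballI)
  fix a assume "a \<in> {..<arity (Mop r d (ext_fst f))}"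
  then show "app (Mop r d (ext_fst f)) (map (koszul G (degree g)) (take a xs) @
       app g (map (koszul G 0) (take (arity g) (drop a xs))) # drop (a + arity g) xs) = 0"
    using assms(2,3) by (auto simp: ext_fst_def zero_prod_def intro!: multilinear_zero[OF assms(1)])
qed

lemma brace_ext_snd_vanishes:
  assumes "multilinear s1 s2 r f" "\<And>ys. snd (app g ys) = 0" "length xs + 1 = r + arity g"
  shows "app (brace G (Mop r d (ext_snd f)) [g]) xs = 0"
  unfolding brace_single
proof (rule sum.neutral, rule ballI)
  fix a assume "a \<in> {..<arity (Mop r d (ext_snd f))}"
  then show "app (Mop r d (ext_snd f)) (map (koszul G (degree g)) (take a xs) @
       app g (map (koszul G 0) (take (arity g) (drop a xs))) # drop (a + arity g) xs) = 0"
    using assms(2,3) by (auto simp: ext_snd_def zero_prod_def intro!: multilinear_zero[OF assms(1)])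
qed

text \<open>An operation reading \<open>M\<close> cannot distinguish insertions with the same \<open>M\<close>-part; this replaces
  \<open>b = m + \<rho>\<close> by \<open>\<rho>\<close> under \<open>sB\<close>.\<close>

lemma brace_ext_snd_cong:
  assumes "arity g = arity g'" "degree g = degree g'" "\<And>ys. snd (app g ys) = snd (app g' ys)"
  shows "app (brace G (Mop r d (ext_snd f)) [g]) xs = app (brace G (Mop r d (ext_snd f)) [g']) xs"
  unfolding brace_single by (simp add: ext_snd_def assms)

lemma brace_ext_fst_ext_fst:
  fixes sA :: "'k::field \<Rightarrow> 'a::ab_group_add \<Rightarrow> 'a" and sM :: "'k \<Rightarrow> 'm::ab_group_add \<Rightarrow> 'm"
  assumes "graded_space sA GA" "graded_space sM GM"
  shows "app (brace (dsum_grading GA GM) (Mop j d (ext_fst f)) [Mop i e (ext_fst g)]) xs =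
     (app (brace GA (Mop j d f) [Mop i e g]) (map fst xs), 0)"
proof -
  have [simp]: "fst \<circ> koszul (dsum_grading GA GM) e' = koszul GA e' \<circ> fst" for e'
    by (simp add: fun_eq_iff fst_koszul_dsum[OF assms])
  show ?thesis
    unfolding brace_single
    by (simp add: ext_fst_def prod_eq_iff fst_sum snd_sum take_map drop_map)
qed

lemma snd_app_brace_ext_snd: "snd (app (brace G (Mop r d (ext_snd f)) gs) xs) = 0"
  by (simp add: brace_def ext_snd_def snd_sum)

text \<open>When as many operations are inserted as there are slots, no argument is left over between them:
  every entry of the resulting list is a value of an inserted operation.\<close>

lemma plug_without_gaps:
  assumes "length as = length gs + 1" "sum_list as = 0" "length xs = sum_list (map arity gs)"
  shows "length (plug G as gs xs) = length gs \<and>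
    set (plug G as gs xs) \<subseteq> (\<Union>g\<in>set gs. range (app g))"
  using assms
proof (induction gs arbitrary: as xs)
  case Nil
  then show ?case by (auto simp: length_Suc_conv)
next
  case (Cons g gs)
  obtain as' where as: "as = 0 # as'" using Cons.prems by (cases as) auto
  have "length (plug G as' gs (drop (arity g) xs)) = length gs \<and>
    set (plug G as' gs (drop (arity g) xs)) \<subseteq> (\<Union>g\<in>set gs. range (app g))"
    using Cons.prems by (intro Cons.IH) (auto simp: as)
  then show ?case by (auto simp: as)
qed

section \<open>The bimodule operations on the direct sum\<close>

lemma fst_ext_bimod: "fst (ext_bimod \<rho> k xs) = 0"
  by (simp add: ext_bimod_def fst_sum)

lemma snd_ext_bimod:
  "snd (ext_bimod \<rho> k xs) =
     (\<Sum>p = 1..k. \<rho> k p (map fst (take (p - 1) xs)) (snd (xs ! (p - 1))) (map fst (drop p xs)))"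
  by (simp add: ext_bimod_def snd_sum)

text \<open>Linearity in the slot \<open>i\<close> of the list comes from a different part of the multilinearity of \<open>f\<close>
  according as \<open>i\<close> is to the left of, at, or to the right of the module position.\<close>

lemma bimodule_map_linear_slot:
  assumes "graded_bimodule_map sA GA sM GM (p - 1) (k - p) d f"
    and "vector_space sA" "vector_space sM"
    and "1 \<le> p" "p \<le> k" "length xs = k" "i < k"
  shows "Vector_Spaces.linear (module_prod.scale sA sM) sM
    (\<lambda>v. f (map fst (take (p - 1) (xs[i := v]))) (snd (xs[i := v] ! (p - 1)))
           (map fst (drop p (xs[i := v]))))"
proof -
  note sc = scale_prod_eq[OF assms(2,3)]
  note vs = vector_space_prod_scale[OF assms(2,3)] assms(2,3)
  have lu: "Vector_Spaces.linear sM sM (\<lambda>u. f us u ws)"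
    and ll: "multilinear sA sM (p - 1) (\<lambda>us. f us u ws)"
    and lr: "multilinear sA sM (k - p) (\<lambda>ws. f us u ws)"
    if "length us = p - 1" "length ws = k - p" for us u ws
    using assms(1) that unfolding graded_bimodule_map_def by blast+
  let ?us = "map fst (take (p - 1) xs)" and ?ws = "map fst (drop p xs)"
  have len: "length ?us = p - 1" "length ?ws = k - p" using assms by auto
  consider "i < p - 1" | "i = p - 1" | "p \<le> i" by linarith
  then show ?thesis
  proof cases
    case 1
    have "Vector_Spaces.linear sA sM (\<lambda>a. f (?us[i := a]) (snd (xs ! (p - 1))) ?ws)"
      using ll[OF len] len 1 unfolding multilinear_def by blast
    with 1 show ?thesis
      by (simp add: Vector_Spaces.linear_iff vs sc take_update_swap map_update)
  next
    case 2
    with lu[OF len] assms(4,6,7) show ?thesis by (simp add: Vector_Spaces.linear_iff vs sc)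
  next
    case 3
    then have j: "i - p < k - p" using assms by auto
    have "Vector_Spaces.linear sA sM (\<lambda>a. f ?us (snd (xs ! (p - 1))) (?ws[i - p := a]))"
      using lr[OF len] len j unfolding multilinear_def by blast
    with 3 assms(4) show ?thesis
      by (simp add: Vector_Spaces.linear_iff vs sc drop_update_swap map_update)
  qed
qed

lemma graded_multilinear_structure:
  fixes sA :: "'k::field \<Rightarrow> 'a::ab_group_add \<Rightarrow> 'a" and sM :: "'k \<Rightarrow> 'm::ab_group_add \<Rightarrow> 'm"
  assumes "graded_space sA GA" "graded_space sM GM"
    and m: "graded_multilinear sA GA sA GA k d f"
    and \<rho>: "\<And>p. 1 \<le> p \<Longrightarrow> p \<le> k \<Longrightarrow> graded_bimodule_map sA GA sM GM (p - 1) (k - p) d (\<rho> k p)"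
  shows "graded_multilinear (module_prod.scale sA sM) (dsum_grading GA GM)
     (module_prod.scale sA sM) (dsum_grading GA GM) k d (\<lambda>xs. ext_fst f xs + ext_bimod \<rho> k xs)"
proof -
  have vs: "vector_space sA" "vector_space sM" using assms by (auto simp: graded_space_def)
  interpret A: vector_space sA by (fact vs)
  interpret M: vector_space sM by (fact vs)
  note sc = scale_prod_eq[OF vs] and vsp = vector_space_prod_scale[OF vs]
  have P: "multilinear (module_prod.scale sA sM) (module_prod.scale sA sM) k (ext_bimod \<rho> k)"
    unfolding multilinear_def
  proof (intro allI impI)
    fix xs :: "('a \<times> 'm) list" and i
    assume "length xs = k" "i < k"
    then have "Vector_Spaces.linear (module_prod.scale sA sM) sM
      (\<lambda>v. \<rho> k p (map fst (take (p - 1) (xs[i := v]))) (snd (xs[i := v] ! (p - 1)))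
           (map fst (drop p (xs[i := v]))))" if "p \<in> {1..k}" for p
      using that by (intro bimodule_map_linear_slot[OF \<rho> vs]) auto
    then show "Vector_Spaces.linear (module_prod.scale sA sM) (module_prod.scale sA sM)
        (\<lambda>v. ext_bimod \<rho> k (xs[i := v]))"
      by (auto simp: Vector_Spaces.linear_iff vsp prod_eq_iff sc fst_ext_bimod snd_ext_bimod
          sum.distrib M.scale_sum_right A.scale_zero_right)
  qed
  have F: "Vector_Spaces.linear (module_prod.scale sA sM) (module_prod.scale sA sM)
        (\<lambda>v. ext_fst f (xs[i := v]))"
    if "length xs = k" "i < k" for xs :: "('a \<times> 'm) list" and i
  proof -
    have "Vector_Spaces.linear sA sA (\<lambda>v. f ((map fst xs)[i := v]))"
      using m that unfolding graded_multilinear_def multilinear_def by simp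
    then show ?thesis
      by (simp add: Vector_Spaces.linear_iff vsp prod_eq_iff sc ext_fst_def map_update)
  qed
  have "multilinear (module_prod.scale sA sM) (module_prod.scale sA sM) k
      (\<lambda>xs. ext_fst f xs + ext_bimod \<rho> k xs)"
    using F P unfolding multilinear_def Vector_Spaces.linear_iff by (simp add: sc add_ac prod_eq_iff vs
      vector_space.vector_space_assms(1))
  moreover have "ext_fst f xs + ext_bimod \<rho> k xs \<in> dsum_grading GA GM (d + sum_list es)"
    if len: "length xs = k" and h: "list_all2 (\<lambda>x e. x \<in> dsum_grading GA GM e) xs es" for xs es
  proof -
    have hf: "list_all2 (\<lambda>x e. x \<in> GA e) (map fst xs) es"
      using h by (auto simp: list_all2_conv_all_nth dsum_grading_def mem_Times_iff)
    have lene: "length es = k" using h len by (simp add: list_all2_lengthD)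
    have "f (map fst xs) \<in> GA (d + sum_list es)"
      using m hf len unfolding graded_multilinear_def by simp
    moreover have "snd (ext_bimod \<rho> k xs) \<in> GM (d + sum_list es)"
      unfolding snd_ext_bimod
    proof (rule M.subspace_sum)
      show "M.subspace (GM (d + sum_list es))" using assms(2) by (simp add: graded_space_def)
      fix p assume "p \<in> {1..k}"
      then have p: "1 \<le> p" "p \<le> k" by auto
      have "es = take (p - 1) es @ es ! (p - 1) # drop p es"
        using p lene id_take_nth_drop[of "p - 1" es] by simp
      then have sum: "sum_list es = sum_list (take (p - 1) es) + es ! (p - 1) + sum_list (drop p es)"
        by (metis sum_list.append sum_list.Cons add.assoc)
      have "list_all2 (\<lambda>x e. x \<in> GA e) (map fst (take (p - 1) xs)) (take (p - 1) es)"
        "list_all2 (\<lambda>x e. x \<in> GA e) (map fst (drop p xs)) (drop p es)"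
        using hf by (auto simp: take_map[symmetric] drop_map[symmetric])
      moreover have "snd (xs ! (p - 1)) \<in> GM (es ! (p - 1))"
        using h p len lene by (auto simp: list_all2_conv_all_nth dsum_grading_def mem_Times_iff)
      ultimately have "\<rho> k p (map fst (take (p - 1) xs)) (snd (xs ! (p - 1))) (map fst (drop p xs))
          \<in> GM (d + sum_list (take (p - 1) es) + es ! (p - 1) + sum_list (drop p es))"
        using \<rho>[OF p] p len unfolding graded_bimodule_map_def by simp
      then show "\<rho> k p (map fst (take (p - 1) xs)) (snd (xs ! (p - 1))) (map fst (drop p xs))
          \<in> GM (d + sum_list es)" by (simp add: sum add.assoc)
    qed
    ultimately show ?thesis
      by (simp add: dsum_grading_def mem_Times_iff fst_ext_bimod ext_fst_def)
  qed
  ultimately show "graded_multilinear (module_prod.scale sA sM) (dsum_grading GA GM)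
     (module_prod.scale sA sM) (dsum_grading GA GM) k d (\<lambda>xs. ext_fst f xs + ext_bimod \<rho> k xs)"
    unfolding graded_multilinear_def by blast
qed

lemma graded_multilinear_ext_snd:
  fixes sA :: "'k::field \<Rightarrow> 'a::ab_group_add \<Rightarrow> 'a" and sM :: "'k \<Rightarrow> 'm::ab_group_add \<Rightarrow> 'm"
  assumes "vector_space sA" "vector_space sM" "\<And>n. module.subspace sM (HM n)"
    and f: "graded_multilinear sM GM sA HA k d f"
  shows "graded_multilinear (module_prod.scale sA sM) (dsum_grading GA GM)
     (module_prod.scale sA sM) (dsum_grading HA HM) k d (ext_snd f)"
proof -
  interpret M: vector_space sM by fact
  note sc = scale_prod_eq[OF assms(1,2)] and vsp = vector_space_prod_scale[OF assms(1,2)]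
  have "multilinear (module_prod.scale sA sM) (module_prod.scale sA sM) k (ext_snd f)"
    unfolding multilinear_def
  proof (intro allI impI)
    fix xs :: "('a \<times> 'm) list" and i
    assume "length xs = k" "i < k"
    then have "Vector_Spaces.linear sM sA (\<lambda>v. f ((map snd xs)[i := v]))"
      using f unfolding graded_multilinear_def multilinear_def by simp
    then show "Vector_Spaces.linear (module_prod.scale sA sM) (module_prod.scale sA sM)
        (\<lambda>v. ext_snd f (xs[i := v]))"
      by (simp add: Vector_Spaces.linear_iff vsp prod_eq_iff sc ext_snd_def map_update)
  qed
  moreover have "ext_snd f xs \<in> dsum_grading HA HM (d + sum_list es)"
    if "length xs = k" "list_all2 (\<lambda>x e. x \<in> dsum_grading GA GM e) xs es" for xs es
  proof -
    have "list_all2 (\<lambda>x e. x \<in> GM e) (map snd xs) es"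
      using that by (auto simp: list_all2_conv_all_nth dsum_grading_def mem_Times_iff)
    then show ?thesis using f that assms(3)
      by (auto simp: graded_multilinear_def dsum_grading_def ext_snd_def M.subspace_0)
  qed
  ultimately show ?thesis unfolding graded_multilinear_def by blast
qed

text \<open>Every summand of the extended operation is linear in its module argument, which is zero here.\<close>

lemma ext_bimod_vanishes:
  assumes "\<And>p. 1 \<le> p \<Longrightarrow> p \<le> k \<Longrightarrow> graded_bimodule_map sA GA sM GM (p - 1) (k - p) d (\<rho> k p)"
    and "length xs = k" "\<And>v. v \<in> set xs \<Longrightarrow> snd v = 0"
  shows "ext_bimod \<rho> k xs = 0"
proof -
  have "\<rho> k p (map fst (take (p - 1) xs)) (snd (xs ! (p - 1))) (map fst (drop p xs)) = 0"
    if p: "p \<in> {1..k}" for p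
  proof -
    have "Vector_Spaces.linear sM sM
        (\<lambda>u. \<rho> k p (map fst (take (p - 1) xs)) u (map fst (drop p xs)))"
    proof -
      have "length (map fst (take (p - 1) xs)) = p - 1" "length (map fst (drop p xs)) = k - p"
        using p assms(2) by auto
      then show ?thesis
        using assms(1)[of p] p unfolding graded_bimodule_map_def by auto
    qed
    moreover have "snd (xs ! (p - 1)) = 0"
      using assms(2) p by (intro assms(3) nth_mem) auto
    ultimately show ?thesis using linear_map_zero by metis
  qed
  then show ?thesis by (simp add: prod_eq_iff fst_ext_bimod snd_ext_bimod)
qed

section \<open>The two families of identities\<close>

text \<open>The direct sum \<open>A \<oplus> M\<close> with \<open>b = m + \<rho>\<close> is the square-zero extension of the algebra by the bimodule.\<close>

lemma A_infinity_dsum: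
  fixes sA :: "'k::field \<Rightarrow> 'a::ab_group_add \<Rightarrow> 'a" and sM :: "'k \<Rightarrow> 'm::ab_group_add \<Rightarrow> 'm"
  assumes "A_infinity_1_algebra sA GA m" "A_infinity_1_bimodule sA GA m sM GM \<rho>"
    and n: "1 \<le> n" "length xs = n"
  defines "b \<equiv> \<lambda>k. Mop k (-1) (\<lambda>xs. ext_fst (m k) xs + ext_bimod \<rho> k xs)"
  shows "(\<Sum>i = 1..n. app (brace (dsum_grading GA GM) (b (n - i + 1)) [b i]) xs) = 0"
proof -
  define G where "G = dsum_grading GA GM"
  define M where "M = (\<lambda>k. Mop k (-1) (ext_fst (m k) :: ('a \<times> 'm) list \<Rightarrow> 'a \<times> 'm))"
  define P where "P = (\<lambda>k. Mop k (-1) (ext_bimod \<rho> k))"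
  let ?I = "{(i, j). 1 \<le> i \<and> 1 \<le> j \<and> i + j = n + 1}"
  have gs: "graded_space sA GA" "graded_space sM GM"
    and m: "\<And>k. 1 \<le> k \<Longrightarrow> graded_multilinear sA GA sA GA k (-1) (m k)"
    and \<rho>: "\<And>k p. 1 \<le> p \<Longrightarrow> p \<le> k \<Longrightarrow>
      graded_bimodule_map sA GA sM GM (p - 1) (k - p) (-1) (\<rho> k p)"
    using assms by (auto simp: A_infinity_1_algebra_def A_infinity_1_bimodule_def)
  have bim: "(\<Sum>(i, j)\<in>?I. app (brace G (P j) [M i]) xs + app (brace G (P j) [P i]) xs) = 0"
    using assms(2) n unfolding A_infinity_1_bimodule_def Let_def G_def M_def P_def by blast
  have alg: "(\<Sum>(i, j)\<in>?I. app (brace GA (Mop j (-1) (m j)) [Mop i (-1) (m i)]) (map fst xs)) = 0"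
    using assms(1) n unfolding A_infinity_1_algebra_def by simp
  have split: "app (brace G (b j) [b i]) xs =
      (app (brace GA (Mop j (-1) (m j)) [Mop i (-1) (m i)]) (map fst xs), 0) +
      (app (brace G (P j) [M i]) xs + app (brace G (P j) [P i]) xs)"
    if ij: "(i, j) \<in> ?I" for i j
  proof -
    have j: "1 \<le> i" "1 \<le> j" "length xs + 1 = i + j" using ij n by auto
    note ml = graded_multilinear_structure[where \<rho> = \<rho>, OF gs m[OF j(2)] \<rho>]
    have mb: "multilinear (module_prod.scale sA sM) (module_prod.scale sA sM) j
        (\<lambda>xs. ext_fst (m j) xs + ext_bimod \<rho> j xs)"
      using ml by (simp add: graded_multilinear_def)
    have mm: "multilinear sA sA j (m j)" using m[OF j(2)] by (simp add: graded_multilinear_def)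
    \<comment> \<open>The one term that neither hypothesis covers.\<close>
    have MP: "app (brace G (M j) [P i]) xs = 0"
      unfolding M_def using j by (intro brace_ext_fst_vanishes[OF mm]) (auto simp: P_def fst_ext_bimod)
    have "app (brace G (b j) [b i]) xs = app (brace G (b j) [M i]) xs + app (brace G (b j) [P i]) xs"
      unfolding b_def M_def P_def by (rule brace_add_right[OF mb j(1,3)])
    also have "\<dots> = app (brace G (M j) [M i]) xs + app (brace G (P j) [M i]) xs +
        (app (brace G (M j) [P i]) xs + app (brace G (P j) [P i]) xs)"
      unfolding b_def M_def P_def brace_add_left by (rule refl)
    also have "app (brace G (M j) [M i]) xs =
        (app (brace GA (Mop j (-1) (m j)) [Mop i (-1) (m i)]) (map fst xs), 0)"
      unfolding G_def M_def by (rule brace_ext_fst_ext_fst[OF gs])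
    finally show ?thesis unfolding MP by (simp only: add_ac add_0_left add_0_right)
  qed
  \<comment> \<open>The two structures index their identities differently: by pairs with \<open>i + j = n + 1\<close>, and by \<open>i\<close>.\<close>
  have bij: "bij_betw (\<lambda>i. (i, n - i + 1)) {1..n} ?I"
    by (rule bij_betwI[where g = fst]) auto
  have "(\<Sum>i = 1..n. app (brace G (b (n - i + 1)) [b i]) xs) =
      (\<Sum>(i, j)\<in>?I. app (brace G (b j) [b i]) xs)"
    using sum.reindex_bij_betw[OF bij, of "\<lambda>(i, j). app (brace G (b j) [b i]) xs"] by simp
  also have "\<dots> = (\<Sum>(i, j)\<in>?I.
        (app (brace GA (Mop j (-1) (m j)) [Mop i (-1) (m i)]) (map fst xs), 0) +
        (app (brace G (P j) [M i]) xs + app (brace G (P j) [P i]) xs))"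
    by (rule sum.cong) (use split in auto)
  also have "\<dots> = (\<Sum>(i, j)\<in>?I. app (brace GA (Mop j (-1) (m j)) [Mop i (-1) (m i)]) (map fst xs), 0) +
      (\<Sum>(i, j)\<in>?I. app (brace G (P j) [M i]) xs + app (brace G (P j) [P i]) xs)"
    by (simp add: sum.distrib case_prod_unfold prod_eq_iff fst_sum snd_sum)
  also have "\<dots> = 0" unfolding alg bim by (simp add: zero_prod_def)
  finally show ?thesis by (simp add: G_def)
qed

text \<open>Stated additively, since arities are natural numbers and subtraction would truncate. It ensures
  that the outermost operation of a nested brace is evaluated on a list of the right length.\<close>

lemma arity_nested_braces:
  assumes "\<forall>r\<in>set rs. 1 \<le> r" "\<And>r. arity (R r) = r"
  shows "arity (foldr (\<lambda>r g. brace G (R r) [g]) rs g) + length rs = sum_list rs + arity g"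
  using assms(1) by (induction rs) (auto simp: brace_def assms(2))

text \<open>The alternating sum over \<open>t\<close> collapses already for a single composition \<open>r\<^sub>1, \<dots>, r\<^sub>p\<close>. The
  operators \<open>R\<close> have degree \<open>0\<close> here: they stand for \<open>sB\<close>.\<close>

lemma Nijenhuis_sum_dsum:
  fixes \<rho> :: "nat \<Rightarrow> nat \<Rightarrow> 'a::ab_group_add list \<Rightarrow> 'm::ab_group_add \<Rightarrow> 'a list \<Rightarrow> 'm"
    and m :: "nat \<Rightarrow> 'a list \<Rightarrow> 'a"
  assumes vs: "vector_space sA" "vector_space sM"
    and \<rho>: "\<And>k p. 1 \<le> p \<Longrightarrow> p \<le> k \<Longrightarrow> graded_bimodule_map sA GA sM GM (p - 1) (k - p) d (\<rho> k p)"
    and B: "\<And>r. 1 \<le> r \<Longrightarrow> multilinear sM sA r (B r)"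
    and rs: "rs \<in> compositions n" and xs: "length xs = n"
  defines "M \<equiv> \<lambda>k. Mop k d (ext_fst (m k))" and "P \<equiv> \<lambda>k. Mop k d (ext_bimod \<rho> k)"
    and "b \<equiv> \<lambda>k. Mop k d (\<lambda>xs. ext_fst (m k) xs + ext_bimod \<rho> k xs)"
    and "R \<equiv> \<lambda>r. Mop r 0 (ext_snd (B r))"
  shows "(\<Sum>t = 0..length rs. module_prod.scale sA sM ((-1) ^ t)
      (app (foldr (\<lambda>r g. brace G (R r) [g]) (take t rs)
        (brace G (b (length rs)) (map R (drop t rs)))) xs)) =
    app (brace G (M (length rs)) (map R rs)) xs -
    app (brace G (R (hd rs)) [brace G (P (length rs)) (map R (tl rs))]) xs"
proof -
  define p where "p = length rs"
  define T where "T = (\<lambda>t. app (foldr (\<lambda>r g. brace G (R r) [g]) (take t rs)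
        (brace G (b p) (map R (drop t rs)))) xs)"
  have pos: "\<forall>r\<in>set rs. 1 \<le> r" and n: "sum_list rs = n" and "rs \<noteq> []"
    using rs by (auto simp: compositions_def)
  then obtain r rs' where rs_eq: "rs = r # rs'" by (cases rs) auto
  have [simp]: "arity (R r) = r" "degree (R r) = 0" for r by (simp_all add: R_def)
  have arR: "map arity (map R ts) = ts" for ts by (induction ts) auto
  have sndR: "snd (app (R r) ys) = 0" for r ys by (simp add: R_def ext_snd_def)

  \<comment> \<open>All inputs of \<open>b\<^sub>p\<close> lie in \<open>A\<close>, so its bimodule part vanishes.\<close>
  have T0: "T 0 = app (brace G (M p) (map R rs)) xs"
  proof -
    have "app (brace G (P p) (map R rs)) xs = 0"
      unfolding brace_def mop.sel
    proof (rule sum.neutral, rule ballI)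
      fix as assume "as \<in> {as. length as = length (map R rs) + 1 \<and>
        sum_list as + length (map R rs) = arity (P p)}"
      then have "length as = length (map R rs) + 1" "sum_list as = 0"
        by (auto simp: P_def p_def)
      moreover have "length xs = sum_list (map arity (map R rs))"
        unfolding arR using xs n by simp
      ultimately have "length (plug G as (map R rs) xs) = p"
        "set (plug G as (map R rs) xs) \<subseteq> (\<Union>g\<in>set (map R rs). range (app g))"
        using plug_without_gaps unfolding p_def by (metis length_map, blast)
      then show "app (P p) (plug G as (map R rs) xs) = 0"
        unfolding P_def mop.sel using sndR by (intro ext_bimod_vanishes[OF \<rho>]) auto
    qed
    then show ?thesis
      by (simp add: T_def b_def M_def P_def brace_add_left)
  qed

  \<comment> \<open>The outer operation reads only the \<open>M\<close>-part of \<open>b\<^sub>p{\<dots>}\<close>.\<close>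
  have T1: "T 1 = app (brace G (R (hd rs)) [brace G (P p) (map R (tl rs))]) xs"
  proof -
    have "snd (app (brace G (b p) gs) ys) = snd (app (brace G (P p) gs) ys)" for gs ys
      by (simp add: b_def P_def brace_add_left) (simp add: brace_def ext_fst_def snd_sum)
    then have "app (brace G (Mop r 0 (ext_snd (B r))) [brace G (b p) (map R rs')]) xs =
      app (brace G (Mop r 0 (ext_snd (B r))) [brace G (P p) (map R rs')]) xs"
      by (rule brace_ext_snd_cong[rotated 2]) (simp_all add: brace_def b_def P_def)
    then show ?thesis by (simp add: T_def rs_eq R_def)
  qed

  \<comment> \<open>The outermost operation is applied to a value of the next one, which lies in \<open>A\<close>.\<close>
  have T2: "T t = 0" if t: "2 \<le> t" "t \<le> p" for t
  proof -
    obtain r2 rs2 where rs': "rs' = r2 # rs2" using t by (cases rs') (auto simp: p_def rs_eq)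
    obtain t' where t': "t = Suc (Suc t')" using t by (metis add_2_eq_Suc le_Suc_ex)
    define g0 where "g0 = brace G (b p) (map R (drop t rs))"
    define g where "g = foldr (\<lambda>r g. brace G (R r) [g]) (r2 # take t' rs2) g0"
    have Tt: "T t = app (brace G (Mop r 0 (ext_snd (B r))) [g]) xs"
      by (simp add: T_def g_def g0_def rs_eq rs' t' R_def)
    have "arity g0 = p + sum_list (drop t rs) - (p - t)"
      unfolding g0_def brace_def mop.sel arR by (simp add: b_def p_def)
    then have ar0: "arity g0 = t + sum_list (drop t' rs2)"
      using t by (simp add: rs_eq rs' t')
    have "arity g + length (r2 # take t' rs2) = sum_list (r2 # take t' rs2) + arity g0"
      unfolding g_def
      by (rule arity_nested_braces) (use pos in \<open>auto simp: rs_eq rs' dest: in_set_takeD\<close>)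
    moreover have "length (take t' rs2) = t'" using t by (simp add: p_def rs_eq rs' t')
    moreover have "sum_list (take t' rs2) + sum_list (drop t' rs2) = sum_list rs2"
      by (metis append_take_drop_id sum_list.append)
    ultimately have "length xs + 1 = r + arity g"
      using xs n ar0 by (simp add: rs_eq rs' t')
    moreover have "snd (app g ys) = 0" for ys
      by (simp add: g_def R_def snd_app_brace_ext_snd)
    moreover have "multilinear sM sA r (B r)" using pos by (intro B) (simp add: rs_eq)
    ultimately show ?thesis unfolding Tt by (intro brace_ext_snd_vanishes)
  qed

  interpret A: vector_space sA by fact
  interpret M: vector_space sM by fact
  have sc: "module_prod.scale sA sM c v = (sA c (fst v), sM c (snd v))" for c v
    by (rule scale_prod_eq[OF vs])
  have "(\<Sum>t = 0..p. module_prod.scale sA sM ((-1) ^ t) (T t)) =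
      (\<Sum>t\<in>{0, 1}. module_prod.scale sA sM ((-1) ^ t) (T t))"
  proof (rule sum.mono_neutral_right)
    show "\<forall>t\<in>{0..p} - {0, 1}. module_prod.scale sA sM ((-1) ^ t) (T t) = 0"
    proof
      fix t assume "t \<in> {0..p} - {0, 1}"
      then have "T t = 0" by (intro T2) auto
      then show "module_prod.scale sA sM ((-1) ^ t) (T t) = 0"
        by (simp add: sc zero_prod_def)
    qed
  qed (auto simp: p_def rs_eq)
  also have "\<dots> = T 0 - T 1" by (simp add: sc prod_eq_iff)
  finally show ?thesis unfolding T0 T1 by (simp add: T_def p_def)
qed

theorem theorem6p7:
  fixes sA :: "'k::field_char_0 \<Rightarrow> 'a::ab_group_add \<Rightarrow> 'a"
    and sM :: "'k \<Rightarrow> 'm::ab_group_add \<Rightarrow> 'm"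
    and GA :: "int \<Rightarrow> 'a set"
    and GM :: "int \<Rightarrow> 'm set"
    and m :: "nat \<Rightarrow> 'a list \<Rightarrow> 'a"
    and \<rho> :: "nat \<Rightarrow> nat \<Rightarrow> 'a list \<Rightarrow> 'm \<Rightarrow> 'a list \<Rightarrow> 'm"
    and B :: "nat \<Rightarrow> 'm list \<Rightarrow> 'a"
  assumes "graded_space sA GA"
    and "graded_space sM GM"
    and "A_infinity_1_algebra sA (susp GA) m"
    and "A_infinity_1_bimodule sA (susp GA) m sM (susp GM) \<rho>"
    and "homotopy_map sA GA sM GM B"
  shows "homotopy_rel_Rota_Baxter sA GA m sM GM \<rho> B \<longleftrightarrow>
    homotopy_Nijenhuis_algebra (module_prod.scale sA sM) (dsum_grading GA GM)
      (\<lambda>n xs. ext_fst (m n) xs + ext_bimod \<rho> n xs) (\<lambda>n. ext_snd (B n))"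
proof -
  let ?sc = "module_prod.scale sA sM"
  let ?G = "dsum_grading (susp GA) (susp GM)"
  have vs: "vector_space sA" "vector_space sM"
    and subM: "\<And>n. module.subspace sM (GM n)"
    using assms by (auto simp: graded_space_def)
  have gs: "graded_space sA (susp GA)" "graded_space sM (susp GM)"
    and m: "\<And>k. 1 \<le> k \<Longrightarrow> graded_multilinear sA (susp GA) sA (susp GA) k (-1) (m k)"
    and \<rho>: "\<And>k p. 1 \<le> p \<Longrightarrow> p \<le> k \<Longrightarrow>
      graded_bimodule_map sA (susp GA) sM (susp GM) (p - 1) (k - p) (-1) (\<rho> k p)"
    and B: "\<And>k. 1 \<le> k \<Longrightarrow> graded_multilinear sM (susp GM) sA GA k (-1) (B k)"
    using assms by (auto simp: A_infinity_1_algebra_def A_infinity_1_bimodule_def homotopy_map_def)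
  have Bm: "\<And>k. 1 \<le> k \<Longrightarrow> multilinear sM sA k (B k)"
    using B by (simp add: graded_multilinear_def)
  define M where "M = (\<lambda>k. Mop k (-1) (ext_fst (m k) :: ('a \<times> 'm) list \<Rightarrow> 'a \<times> 'm))"
  define P where "P = (\<lambda>k. Mop k (-1) (ext_bimod \<rho> k))"
  define b where "b = (\<lambda>k. Mop k (-1) (\<lambda>xs. ext_fst (m k) xs + ext_bimod \<rho> k xs))"
  define R where "R = (\<lambda>r. smop (Mop r (-1) (ext_snd (B r) :: ('a \<times> 'm) list \<Rightarrow> 'a \<times> 'm)))"
  have R_eq: "R = (\<lambda>r. Mop r 0 (ext_snd (B r)))" by (simp add: R_def smop_def)
  have sum_eq: "(\<Sum>rs\<in>compositions n. \<Sum>t = 0..length rs. ?sc ((-1) ^ t)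
        (app (foldr (\<lambda>r g. brace ?G (R r) [g]) (take t rs)
          (brace ?G (b (length rs)) (map R (drop t rs)))) xs)) =
      (\<Sum>rs\<in>compositions n. app (brace ?G (M (length rs)) (map R rs)) xs) -
      (\<Sum>rs\<in>compositions n.
        app (brace ?G (R (hd rs)) [brace ?G (P (length rs)) (map R (tl rs))]) xs)"
    if "length xs = n" for n xs
    unfolding sum_subtractf[symmetric] R_eq M_def P_def b_def
    by (rule sum.cong[OF refl Nijenhuis_sum_dsum[OF vs \<rho> Bm _ that]])
  have b_graded: "\<forall>i\<ge>1. graded_multilinear ?sc ?G ?sc ?G i (-1)
      (\<lambda>xs. ext_fst (m i) xs + ext_bimod \<rho> i xs)"
    using graded_multilinear_structure[where \<rho> = \<rho>, OF gs m \<rho>] by blast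
  have R_graded: "\<forall>i\<ge>1. graded_multilinear ?sc ?G ?sc (dsum_grading GA GM) i (-1) (ext_snd (B i))"
    using graded_multilinear_ext_snd[where HM = GM, OF vs subM B] by blast
  have b_A_infinity: "\<forall>n\<ge>1. \<forall>xs. length xs = n \<longrightarrow>
      (\<Sum>i = 1..n. app (brace ?G (b (n - i + 1)) [b i]) xs) = 0"
    unfolding b_def using A_infinity_dsum[OF assms(3,4)] by blast
  have "homotopy_rel_Rota_Baxter sA GA m sM GM \<rho> B \<longleftrightarrow>
      (\<forall>n\<ge>1. \<forall>xs. length xs = n \<longrightarrow>
        (\<Sum>rs\<in>compositions n. app (brace ?G (M (length rs)) (map R rs)) xs) =
        (\<Sum>rs\<in>compositions n.
          app (brace ?G (R (hd rs)) [brace ?G (P (length rs)) (map R (tl rs))]) xs))"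
    unfolding homotopy_rel_Rota_Baxter_def Let_def M_def P_def R_def using assms(5) by blast
  also have "\<dots> \<longleftrightarrow> (\<forall>n\<ge>1. \<forall>xs. length xs = n \<longrightarrow>
      (\<Sum>rs\<in>compositions n. \<Sum>t = 0..length rs. ?sc ((-1) ^ t)
        (app (foldr (\<lambda>r g. brace ?G (R r) [g]) (take t rs)
          (brace ?G (b (length rs)) (map R (drop t rs)))) xs)) = 0)"
    using sum_eq by (metis (no_types, lifting) right_minus_eq)
  also have "\<dots> \<longleftrightarrow> homotopy_Nijenhuis_algebra ?sc (dsum_grading GA GM)
      (\<lambda>n xs. ext_fst (m n) xs + ext_bimod \<rho> n xs) (\<lambda>n. ext_snd (B n))"
    unfolding homotopy_Nijenhuis_algebra_def Let_def susp_dsum R_def[symmetric] b_def[symmetric]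
    using graded_space_dsum[OF assms(1,2)] b_graded R_graded b_A_infinity
    unfolding R_def b_def by blast
  finally show ?thesis .
qed

end
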